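(* Let $x^\ast$ be an optimal point of the primal problem $\min\{f(Ax): x\ge 0\}$ and let $\nu^\ast$ be the unique optimal point of the dual problem $\max\{g(\nu) : A^T\nu\ge 0\}$, where $g=-f^\ast$. Let $a_i$ denote the $i$th column of $A$. Assume that strict complementary slackness holds: for every $i\in\{1,\dots,n\}$, $x_i^\ast = 0$ if and only if $\langle a_i,\nu^\ast\rangle > 0$. Define $\mathcal{I} = \{i : \langle a_i,\nu^\ast\rangle > 0\}$ to be the index set of zero features. Let the primal feasible point $\hat{x}$ and dual feasible point $\hat{\nu}$ produce a duality gap $\epsilon = f(A\hat{x}) - g(\hat{\nu})$ such that $$\sqrt{\epsilon} < \frac{1}{\sqrt{2L}} \min_{i\in\mathcal{I}} \frac{\langle a_i,\hat{\nu}\rangle}{\|a_i\|}.$$ Then the feature elimination problem eliminates all zero features; that is, for every $i$ with $x_i^\ast=0$, the optimal value of $$\min_\nu\ \langle a_i,\nu\rangle \quad \text{s.t.}\quad \|\nu-\hat{\nu}\|^2\le 2L\epsilon$$ is strictly positive.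
   Context: Standing assumptions: $f:\mathbb{R}^m\to\overline{\mathbb{R}}=\mathbb{R}\cup\{\pm\infty\}$ is a proper, convex, extended-value function with globally $L$-Lipschitz continuous gradient, $L>0$; $A$ is a real $m\times n$ matrix with full rank; and $\operatorname{int}(\operatorname{dom} f)\cap A\mathbb{R}^n_+$ is non-empty, where $\mathbb{R}^n_+=\{x\in\mathbb{R}^n : x\ge 0\}$. Vector inequalities are componentwise and $\|\cdot\|$ is the Euclidean norm. The primal problem is $p^\ast = \min_x f(Ax)$ subject to $x\ge 0$. With the convex conjugate $f^\ast(y)=\sup_z \langle y,z\rangle - f(z)$ and $g(\nu) = -f^\ast(\nu)$, the dual problem is $d^\ast=\max_\nu g(\nu)$ subject to $A^T\nu\ge 0$. A point $x$ is primal feasible if $x\ge0$; a point $\nu$ is dual feasible if $A^T\nu\ge0$. The function $g$ is $1/L$-strongly concave, strong duality holds ($p^\ast=d^\ast$), and the dual optimal point $\nu^\ast$ is unique. Feature elimination: given a primal feasible $\hat x$ and dual feasible $\hat\nu$ with duality gap $\epsilon=f(A\hat x)-g(\hat\nu)$, the feature elimination subproblem for feature (column) $a_i$ is $\min_\nu\{\langle a_i,\nu\rangle : \|\nu-\hat\nu\|^2\le 2L\epsilon\}$. Feature $i$ is eliminated when the optimal value of this subproblem is strictly positive. A zero feature is an index $i$ with $x_i^\ast=0$. A minimum over an empty index set is $+\infty$. *)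

theory Defs
  imports "HOL-Analysis.Analysis"
begin

definition effective_domain :: "('a \<Rightarrow> ereal) \<Rightarrow> 'a set" where
  "effective_domain f = {x. f x < \<infinity>}"

definition proper_fun :: "('a \<Rightarrow> ereal) \<Rightarrow> bool" where
  "proper_fun f \<longleftrightarrow> (\<forall>x. f x \<noteq> -\<infinity>) \<and> effective_domain f \<noteq> {}"

(* Used only for proper functions, so that the right-hand side never contains
   \<infinity> + -\<infinity>; at the endpoints of the unit interval 0 * \<infinity> = 0 makes the
   inequality trivial. *)
definition convex_fun :: "('a::real_vector \<Rightarrow> ereal) \<Rightarrow> bool" where
  "convex_fun f \<longleftrightarrow> (\<forall>x y. \<forall>t\<in>{0..1}.
     f ((1 - t) *\<^sub>R x + t *\<^sub>R y) \<le> ereal (1 - t) * f x + ereal t * f y)"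

(* The gradient is taken where it can exist, namely on the interior of the effective domain.
   When f is finite everywhere, this is Lipschitz continuity of the gradient on
   the whole space. *)
definition lipschitz_gradient :: "real \<Rightarrow> ('a::real_inner \<Rightarrow> ereal) \<Rightarrow> bool" where
  "lipschitz_gradient L f \<longleftrightarrow>
     (\<exists>G. (\<forall>x\<in>interior (effective_domain f). GDERIV (\<lambda>z. real_of_ereal (f z)) x :> G x) \<and>
          L-lipschitz_on (interior (effective_domain f)) G)"

definition convex_conjugate :: "('a::real_inner \<Rightarrow> ereal) \<Rightarrow> 'a \<Rightarrow> ereal" where
  "convex_conjugate f y = (SUP z. ereal (y \<bullet> z) - f z)"

definition dual_objective :: "('a::real_inner \<Rightarrow> ereal) \<Rightarrow> 'a \<Rightarrow> ereal" where
  "dual_objective f \<nu> = - convex_conjugate f \<nu>"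

definition full_rank :: "real^'n^'m \<Rightarrow> bool" where
  "full_rank A \<longleftrightarrow> rank A = min CARD('m) CARD('n)"

(* The order on vectors is the componentwise one. *)
definition primal_feasible :: "real^'n \<Rightarrow> bool" where
  "primal_feasible x \<longleftrightarrow> 0 \<le> x"

definition dual_feasible :: "real^'n^'m \<Rightarrow> real^'m \<Rightarrow> bool" where
  "dual_feasible A \<nu> \<longleftrightarrow> 0 \<le> transpose A *v \<nu>"

definition primal_optimal :: "(real^'m \<Rightarrow> ereal) \<Rightarrow> real^'n^'m \<Rightarrow> real^'n \<Rightarrow> bool" where
  "primal_optimal f A x \<longleftrightarrow> is_arg_min (\<lambda>x. f (A *v x)) primal_feasible x"

definition dual_optimal :: "(real^'m \<Rightarrow> ereal) \<Rightarrow> real^'n^'m \<Rightarrow> real^'m \<Rightarrow> bool" where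
  "dual_optimal f A \<nu> \<longleftrightarrow> is_arg_max (dual_objective f) (dual_feasible A) \<nu>"

definition elimination_value ::
    "real \<Rightarrow> real^'n^'m \<Rightarrow> real^'m \<Rightarrow> real \<Rightarrow> 'n \<Rightarrow> ereal" where
  "elimination_value L A \<nu>h \<epsilon> i =
     (INF \<nu>\<in>{\<nu>. (norm (\<nu> - \<nu>h))\<^sup>2 \<le> 2 * L * \<epsilon>}. ereal (column i A \<bullet> \<nu>))"

definition feature_eliminated ::
    "real \<Rightarrow> real^'n^'m \<Rightarrow> real^'m \<Rightarrow> real \<Rightarrow> 'n \<Rightarrow> bool" where
  "feature_eliminated L A \<nu>h \<epsilon> i \<longleftrightarrow> 0 < elimination_value L A \<nu>h \<epsilon> i"

end

theory Submission
  imports Defs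
begin

text \<open>
  Over a ball of radius \<open>r\<close> about \<open>\<nu>h\<close>, a linear functional \<open>\<nu> \<mapsto> \<langle>a, \<nu>\<rangle>\<close> drops below its value at
  the centre by at most \<open>r * \<parallel>a\<parallel>\<close>, by Cauchy-Schwarz. The ball of the elimination problem has radius
  \<open>sqrt (2 * L * \<epsilon>)\<close>, so feature \<open>i\<close> is eliminated as soon as this radius is smaller than
  \<open>\<langle>a\<^sub>i, \<nu>h\<rangle> / \<parallel>a\<^sub>i\<parallel>\<close>, the signed distance of \<open>\<nu>h\<close> from the hyperplane orthogonal to \<open>a\<^sub>i\<close>. The assumed
  bound on the gap says precisely that the radius is smaller than all these distances for \<open>i\<close> in
  \<open>I\<close>. By strict complementarity every zero feature lies in \<open>I\<close>, and \<open>\<langle>a\<^sub>i, \<nu>s\<rangle> > 0\<close> forces \<open>a\<^sub>i \<noteq> 0\<close>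
  there, so that the quotient really is a distance.
\<close>

text \<open>
  Cauchy-Schwarz on the ball. For \<open>\<epsilon> < 0\<close> the ball is empty and the elimination value is \<open>\<infinity>\<close>.
\<close>
lemma elimination_value_ge:
  "ereal (column i A \<bullet> \<nu>h - norm (column i A) * sqrt (2 * L * \<epsilon>)) \<le> elimination_value L A \<nu>h \<epsilon> i"
  unfolding elimination_value_def
proof (rule INF_greatest)
  fix \<nu> assume "\<nu> \<in> {\<nu>. (norm (\<nu> - \<nu>h))\<^sup>2 \<le> 2 * L * \<epsilon>}"
  then have dist: "norm (\<nu> - \<nu>h) \<le> sqrt (2 * L * \<epsilon>)"
    by (simp add: real_le_rsqrt)
  have "- (column i A \<bullet> (\<nu> - \<nu>h)) \<le> norm (column i A) * norm (\<nu> - \<nu>h)"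
    using Cauchy_Schwarz_ineq2[of "column i A" "\<nu> - \<nu>h"] by linarith
  also have "\<dots> \<le> norm (column i A) * sqrt (2 * L * \<epsilon>)"
    using dist by (rule mult_left_mono) simp
  finally show "ereal (column i A \<bullet> \<nu>h - norm (column i A) * sqrt (2 * L * \<epsilon>))
      \<le> ereal (column i A \<bullet> \<nu>)"
    by (simp add: inner_diff_right)
qed

lemma feature_eliminated_if_radius_less:
  assumes "column i A \<noteq> 0"
    and "sqrt (2 * L * \<epsilon>) < (column i A \<bullet> \<nu>h) / norm (column i A)"
  shows "feature_eliminated L A \<nu>h \<epsilon> i"
proof -
  have "0 < ereal (column i A \<bullet> \<nu>h - norm (column i A) * sqrt (2 * L * \<epsilon>))"
    using assms by (simp add: pos_less_divide_eq mult.commute)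
  then show ?thesis
    unfolding feature_eliminated_def using elimination_value_ge by (rule less_le_trans)
qed

theorem theorem5p1:
  fixes f :: "real^'m \<Rightarrow> ereal"
    and A :: "real^'n^'m"
    and L \<epsilon> :: real
    and xs xh :: "real^'n"
    and \<nu>s \<nu>h :: "real^'m"
    and I :: "'n set"
  assumes "proper_fun f"
    and "convex_fun f"
    and "L > 0"
    and "lipschitz_gradient L f"
    and "full_rank A"
    and "interior (effective_domain f) \<inter> (\<lambda>x. A *v x) ` {x. 0 \<le> x} \<noteq> {}"
    and "primal_optimal f A xs"
    and "dual_optimal f A \<nu>s"
    and "\<And>\<nu>. dual_optimal f A \<nu> \<Longrightarrow> \<nu> = \<nu>s"
    and "\<And>i. xs $ i = 0 \<longleftrightarrow> column i A \<bullet> \<nu>s > 0"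
    and "I = {i. column i A \<bullet> \<nu>s > 0}"
    and "primal_feasible xh"
    and "dual_feasible A \<nu>h"
    and "ereal \<epsilon> = f (A *v xh) - dual_objective f \<nu>h"
    and "ereal (sqrt \<epsilon>) <
         ereal (1 / sqrt (2 * L)) * (INF i\<in>I. ereal ((column i A \<bullet> \<nu>h) / norm (column i A)))"
  shows "\<forall>i. xs $ i = 0 \<longrightarrow> feature_eliminated L A \<nu>h \<epsilon> i"
proof (intro allI impI)
  fix i assume "xs $ i = 0"
  then have pos: "column i A \<bullet> \<nu>s > 0"
    using assms(10) by blast
  then have nonzero: "column i A \<noteq> 0"
    by auto
  let ?q = "(column i A \<bullet> \<nu>h) / norm (column i A)"
  have "(INF i\<in>I. ereal ((column i A \<bullet> \<nu>h) / norm (column i A))) \<le> ereal ?q"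
    using pos assms(11) by (intro INF_lower) simp
  then have "ereal (1 / sqrt (2 * L)) * (INF i\<in>I. ereal ((column i A \<bullet> \<nu>h) / norm (column i A)))
      \<le> ereal (1 / sqrt (2 * L)) * ereal ?q"
    using \<open>L > 0\<close> by (intro ereal_mult_left_mono) simp_all
  with assms(15) have "ereal (sqrt \<epsilon>) < ereal (1 / sqrt (2 * L)) * ereal ?q"
    by (rule less_le_trans)
  then have "sqrt \<epsilon> < ?q / sqrt (2 * L)"
    by (simp add: mult.commute)
  moreover have "0 < sqrt (2 * L)"
    using \<open>L > 0\<close> by simp
  ultimately have "sqrt \<epsilon> * sqrt (2 * L) < ?q"
    by (simp only: pos_less_divide_eq)
  then have "sqrt (2 * L * \<epsilon>) < ?q"
    by (simp only: real_sqrt_mult mult_ac)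
  with nonzero show "feature_eliminated L A \<nu>h \<epsilon> i"
    by (rule feature_eliminated_if_radius_less)
qed

end
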